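(* Let $n$ be a positive integer and let $P=S^{n-1}$ be the $(n-1)$-dimensional sphere. Then on the $n$-dimensional sphere $S^n$ there are no $P$-functions.
   Context: **$P$-function.** Let $P$ be a fixed smooth manifold without boundary. A differentiable function on a manifold whose set of critical points is a disjoint union of smooth submanifolds without boundary is called a $P$-function if each of its critical submanifolds is homeomorphic to $P$. *)

theory Defs
  imports "HOL-Analysis.Analysis"
begin

text \<open>
  Manifolds are rendered as embedded smooth submanifolds of Euclidean spaces.
\<close>

text \<open>
  Continuous differentiability of order \<open>k\<close> on an open set: every iterated directional
  derivative of order at most \<open>k\<close> exists and is continuous, and those of order
  less than \<open>k\<close> are (Frechet) differentiable.
\<close>

primrec Ck_on :: "nat \<Rightarrow> 'a::euclidean_space set \<Rightarrow> ('a \<Rightarrow> 'b::real_normed_vector) \<Rightarrow> bool" where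
  "Ck_on 0 U f \<longleftrightarrow> continuous_on U f"
| "Ck_on (Suc k) U f \<longleftrightarrow>
     (\<forall>x\<in>U. f differentiable (at x)) \<and>
     (\<forall>v. Ck_on k U (\<lambda>x. frechet_derivative f (at x) v))"

definition smooth_on :: "'a::euclidean_space set \<Rightarrow> ('a \<Rightarrow> 'b::real_normed_vector) \<Rightarrow> bool" where
  "smooth_on U f \<longleftrightarrow> (\<forall>k. Ck_on k U f)"

definition diffeomorphism ::
  "'a::euclidean_space set \<Rightarrow> 'b::euclidean_space set \<Rightarrow> ('a \<Rightarrow> 'b) \<Rightarrow> ('b \<Rightarrow> 'a) \<Rightarrow> bool" where
  "diffeomorphism U V \<phi> \<psi> \<longleftrightarrow>
     open U \<and> open V \<and> homeomorphism U V \<phi> \<psi> \<and> smooth_on U \<phi> \<and> smooth_on V \<psi>"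

text \<open>
  Embedded smooth \<open>k\<close>-dimensional submanifolds, without boundary, of the ambient Euclidean space,
  described by slice charts.  If \<open>M\<close> is such a submanifold, then the embedded
  submanifolds of the manifold \<open>M\<close> are precisely the sets \<open>N \<subseteq> M\<close> that satisfy this predicate.
\<close>

definition smooth_submanifold :: "nat \<Rightarrow> 'a::euclidean_space set \<Rightarrow> bool" where
  "smooth_submanifold k M \<longleftrightarrow>
     (\<forall>x\<in>M. \<exists>(U::'a set) (V::'a set) \<phi> \<psi> L.
        x \<in> U \<and> diffeomorphism U V \<phi> \<psi> \<and> subspace L \<and> dim L = k \<and> \<phi> ` (M \<inter> U) = L \<inter> V)"

text \<open>Tangent vectors are the velocities of curves that run in \<open>M\<close>.\<close>

definition tangent_space :: "'a::euclidean_space set \<Rightarrow> 'a \<Rightarrow> 'a set" where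
  "tangent_space M x =
     {v. \<exists>\<gamma>::real \<Rightarrow> 'a. \<gamma> 0 = x \<and> (\<forall>\<^sub>F t in at 0. \<gamma> t \<in> M) \<and> (\<gamma> has_vector_derivative v) (at 0)}"

text \<open>
  A derivative \<open>f'\<close> within \<open>M\<close> is determined only on tangent vectors; its restriction to the
  tangent space is the differential of \<open>f\<close>, which has to vanish at a critical point.
\<close>

definition critical_points :: "'a::euclidean_space set \<Rightarrow> ('a \<Rightarrow> real) \<Rightarrow> 'a set" where
  "critical_points M f =
     {x \<in> M. \<exists>f'. (f has_derivative f') (at x within M) \<and> (\<forall>v\<in>tangent_space M x. f' v = 0)}"

text \<open>
  The critical set is the disjoint union of its connected components, and these are the critical
  submanifolds of \<open>f\<close>.  Only the values of \<open>f\<close> on \<open>M\<close> matter.  On a submanifold \<open>M\<close>,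
  differentiability within \<open>M\<close> is the same as differentiability in the charts of \<open>M\<close>.
\<close>

definition P_function ::
  "'p::topological_space set \<Rightarrow> 'a::euclidean_space set \<Rightarrow> ('a \<Rightarrow> real) \<Rightarrow> bool" where
  "P_function P M f \<longleftrightarrow>
     f differentiable_on M \<and>
     (\<forall>C \<in> components (critical_points M f). (\<exists>k. smooth_submanifold k C) \<and> C homeomorphic P)"

end

theory Submission
  imports Defs
begin

text \<open>
  Suppose that every component of the critical set of \<open>f\<close> on \<open>S\<^sup>n\<close> is an embedded copy of
  \<open>S\<^sup>n\<^sup>-\<^sup>1\<close>.  The critical set is not empty, because \<open>f\<close> has an extremum.  For \<open>n = 1\<close> this is
  already absurd, as components are connected and \<open>S\<^sup>0\<close> is not.  Let \<open>n \<ge> 2\<close>.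

  By the Jordan-Brouwer theorem each critical component \<open>C\<close> separates \<open>S\<^sup>n\<close>
  (\<open>sphere_complement_has_component_avoiding_point\<close>), and \<open>f\<close> is constant on \<open>C\<close>, because \<open>C\<close> is a
  connected submanifold of critical points (\<open>constant_on_connected_critical_submanifold\<close>).  So on
  any complementary component \<open>A\<close> of \<open>C\<close>, as in Rolle's theorem, \<open>f\<close> has an extremum, which is a
  further critical point (\<open>critical_point_in_region\<close>).  Its critical component lies in \<open>A\<close> and in
  turn cuts out of \<open>A\<close> a strictly smaller region (\<open>region_inside_critical_point\<close>), and so on.
  If there were only finitely many critical components, an innermost region would give the
  contradiction.

  In general there may be infinitely many, and they may accumulate; since \<open>f\<close> is only
  differentiable, a limit of critical points need not be critical.  The descent can nevertheless be
  continued transfinitely, for the intersection of any chain of regions again contains a critical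
  point (\<open>critical_point_in_chain\<close>).  This is Rolle's argument again if the chain has a least
  region.  If not, the intersection is compact.  At a noncritical point of it where \<open>f\<close> is smallest,
  \<open>f\<close> decreases along some short arc, and at one where it is largest, \<open>f\<close> increases along another.  A region whose boundary value of \<open>f\<close> is at least the smallest value traps the first arc,
  and one whose boundary value is at most the largest value traps the second; so one of the two arcs
  stays in the intersection, which contradicts the extremality.  Hence a maximal chain of regions
  could always be extended (\<open>regions_empty\<close>).
\<close>

section \<open>Critical points and curves\<close>

lemma has_real_derivative_along_curve:
  fixes f :: "'a::euclidean_space \<Rightarrow> real" and \<gamma> :: "real \<Rightarrow> 'a"
  assumes f: "(f has_derivative f') (at (\<gamma> t) within M)"
    and \<gamma>: "(\<gamma> has_vector_derivative v) (at t)"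
    and M: "\<gamma> t \<in> M" "\<forall>\<^sub>F s in at t. \<gamma> s \<in> M"
  shows "((\<lambda>s. f (\<gamma> s)) has_real_derivative f' v) (at t)"
proof -
  obtain e where "e > 0" and e: "\<And>s. s \<noteq> t \<Longrightarrow> dist s t < e \<Longrightarrow> \<gamma> s \<in> M"
    using M(2) unfolding eventually_at by auto
  have eq: "at t within ball t e = at t"
    using \<open>e > 0\<close> by (intro at_within_open) auto
  have "\<gamma> ` ball t e \<subseteq> M"
    using e M(1) by (force simp: dist_commute)
  then have f_image: "(f has_derivative f') (at (\<gamma> t) within \<gamma> ` ball t e)"
    using f has_derivative_subset by blast
  have "(\<gamma> has_derivative (\<lambda>h. h *\<^sub>R v)) (at t within ball t e)"
    using \<gamma> unfolding eq has_vector_derivative_def .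
  from has_derivative_in_compose[OF this f_image]
  have *: "((\<lambda>s. f (\<gamma> s)) has_derivative (\<lambda>h. f' (h *\<^sub>R v))) (at t)"
    unfolding eq .
  have "f' (h *\<^sub>R v) = f' v * h" for h
    using linear_scale[OF has_derivative_linear[OF f]] by simp
  with * show ?thesis
    unfolding has_field_derivative_def by (simp add: fun_eq_iff)
qed

lemma critical_points_stationary_along_curve:
  fixes f :: "'a::euclidean_space \<Rightarrow> real"
  assumes \<gamma>: "(\<gamma> has_vector_derivative v) (at t)"
    and crit: "\<gamma> t \<in> critical_points M f" and ev: "\<forall>\<^sub>F s in at t. \<gamma> s \<in> M"
  shows "((\<lambda>s. f (\<gamma> s)) has_real_derivative 0) (at t)"
proof -
  obtain f' where f': "(f has_derivative f') (at (\<gamma> t) within M)"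
    and zero: "\<And>w. w \<in> tangent_space M (\<gamma> t) \<Longrightarrow> f' w = 0" and M: "\<gamma> t \<in> M"
    using crit unfolding critical_points_def by auto
  have "((\<lambda>s. \<gamma> (s + t)) has_vector_derivative v) (at 0)"
  proof -
    have "((\<lambda>s. s + t) has_vector_derivative 1) (at 0)"
      by (auto intro!: derivative_eq_intros)
    from vector_diff_chain_at[OF this, of \<gamma> v] \<gamma> show ?thesis
      by (simp add: o_def)
  qed
  moreover have "\<forall>\<^sub>F s in at 0. \<gamma> (s + t) \<in> M"
    using ev unfolding eventually_at_to_0[of _ t] by (simp add: add.commute)
  ultimately have "v \<in> tangent_space M (\<gamma> t)"
    unfolding tangent_space_def by (auto intro!: exI[of _ "\<lambda>s. \<gamma> (s + t)"])
  with has_real_derivative_along_curve[OF f' \<gamma> M ev] zero show ?thesis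
    by simp
qed

lemma critical_points_uminus: "critical_points M (\<lambda>x. - f x) = critical_points M f"
proof -
  have "critical_points M g \<subseteq> critical_points M (\<lambda>x. - g x)" for g
  proof
    fix x assume "x \<in> critical_points M g"
    then obtain g' where "x \<in> M" and g': "(g has_derivative g') (at x within M)"
      and zero: "\<forall>v\<in>tangent_space M x. g' v = 0"
      unfolding critical_points_def by blast
    from has_derivative_minus[OF g'] zero \<open>x \<in> M\<close>
    show "x \<in> critical_points M (\<lambda>x. - g x)"
      unfolding critical_points_def by (auto intro!: exI[of _ "\<lambda>h. - g' h"])
  qed
  from this[of f] this[of "\<lambda>x. - f x"] show ?thesis
    by auto
qed

lemma tangent_spaceE:
  fixes M :: "'a::euclidean_space set"
  assumes "v \<in> tangent_space M x"
  obtains \<gamma> :: "real \<Rightarrow> 'a" where "\<gamma> 0 = x" "\<forall>\<^sub>F t in at 0. \<gamma> t \<in> M"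
    "(\<gamma> has_vector_derivative v) (at 0)"
proof -
  have "\<exists>\<gamma>. \<gamma> 0 = x \<and> (\<forall>\<^sub>F t in at 0. \<gamma> t \<in> M) \<and> (\<gamma> has_vector_derivative v) (at 0)"
    using assms by (simp add: tangent_space_def)
  then show thesis
    by (elim exE conjE) (rule that)
qed

lemma local_minimum_critical:
  fixes f :: "'a::euclidean_space \<Rightarrow> real"
  assumes f: "f differentiable_on M" and A: "openin (top_of_set M) A" "x \<in> A"
    and min: "\<And>y. y \<in> A \<Longrightarrow> f x \<le> f y"
  shows "x \<in> critical_points M f"
proof -
  have "x \<in> M"
    using A openin_subset by fastforce
  then obtain f' where f': "(f has_derivative f') (at x within M)"
    using f unfolding differentiable_on_def differentiable_def by blast
  have "f' v = 0" if v: "v \<in> tangent_space M x" for v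
  proof -
    obtain \<gamma> where \<gamma>: "\<gamma> 0 = x" "\<forall>\<^sub>F t in at 0. \<gamma> t \<in> M"
        "(\<gamma> has_vector_derivative v) (at 0)"
      using tangent_spaceE[OF v] .
    obtain U where "open U" and U: "A = M \<inter> U"
      using A unfolding openin_open by blast
    have "(\<gamma> \<longlongrightarrow> x) (at 0)"
      using has_vector_derivative_continuous[OF \<gamma>(3)] \<gamma>(1) by (simp add: continuous_within)
    then have "\<forall>\<^sub>F t in at 0. \<gamma> t \<in> U"
      using \<open>open U\<close> A U by (intro topological_tendstoD) auto
    with \<gamma>(2) have "\<forall>\<^sub>F t in at 0. f x \<le> f (\<gamma> t)"
      by eventually_elim (use min U in blast)
    then obtain d where "d > 0" and d: "\<And>t. t \<noteq> 0 \<Longrightarrow> dist t 0 < d \<Longrightarrow> f x \<le> f (\<gamma> t)"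
      unfolding eventually_at by auto
    have deriv: "((\<lambda>t. f (\<gamma> t)) has_real_derivative f' v) (at 0)"
      using has_real_derivative_along_curve[of f f' \<gamma> 0 M v] f' \<gamma> \<open>x \<in> M\<close> by simp
    have "\<forall>t. \<bar>0 - t\<bar> < d \<longrightarrow> f (\<gamma> 0) \<le> f (\<gamma> t)"
      using d \<gamma>(1) by (metis abs_minus_commute diff_zero dist_real_def order_refl)
    with deriv \<open>d > 0\<close> show ?thesis
      by (rule DERIV_local_min)
  qed
  with f' \<open>x \<in> M\<close> show ?thesis
    unfolding critical_points_def by blast
qed

lemma local_maximum_critical:
  fixes f :: "'a::euclidean_space \<Rightarrow> real"
  assumes f: "f differentiable_on M" and A: "openin (top_of_set M) A" "x \<in> A"
    and max: "\<And>y. y \<in> A \<Longrightarrow> f y \<le> f x"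
  shows "x \<in> critical_points M f"
  using local_minimum_critical[of "\<lambda>x. - f x" M A x] assms
  by (simp add: critical_points_uminus differentiable_on_minus)

text \<open>
  A slice chart joins any two nearby points of the submanifold by the preimage of a straight
  segment, a differentiable curve of critical points, along which the derivative of the function
  vanishes.  So the function is locally constant, and connectedness does the rest.  The charts are
  essential: by Whitney, a function may vary along a connected set of critical points that contains
  no such curves.
\<close>

lemma constant_on_connected_critical_submanifold:
  fixes f :: "'a::euclidean_space \<Rightarrow> real"
  assumes C: "smooth_submanifold k C" "connected C" "C \<subseteq> critical_points M f"
  shows "f constant_on C"
proof (rule locally_constant_imp_constant[OF \<open>connected C\<close>])
  have "C \<subseteq> M"
    using C(3) unfolding critical_points_def by blast
  fix x assume "x \<in> C"
  with C(1) have "\<exists>(U::'a set) (V::'a set) \<phi> \<psi> L.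
      x \<in> U \<and> diffeomorphism U V \<phi> \<psi> \<and> subspace L \<and> dim L = k \<and> \<phi> ` (C \<inter> U) = L \<inter> V"
    by (simp add: smooth_submanifold_def)
  then obtain U V :: "'a set" and \<phi> \<psi> :: "'a \<Rightarrow> 'a" and L
    where "x \<in> U" and diffeo: "diffeomorphism U V \<phi> \<psi>"
    and L: "subspace L" and slice: "\<phi> ` (C \<inter> U) = L \<inter> V"
    by (elim exE conjE) (rule that)
  have "open U" "open V" and hom: "homeomorphism U V \<phi> \<psi>" and "smooth_on V \<psi>"
    using diffeo unfolding diffeomorphism_def by auto
  then have "Ck_on (Suc 0) V \<psi>"
    unfolding smooth_on_def by blast
  then have \<psi>: "\<psi> differentiable (at z)" if "z \<in> V" for z
    using that by simp
  have "\<phi> x \<in> V"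
    using hom \<open>x \<in> U\<close> unfolding homeomorphism_def by auto
  then obtain e where "e > 0" and e: "ball (\<phi> x) e \<subseteq> V"
    using \<open>open V\<close> openE by blast
  \<comment> \<open>A ball is convex, so the segments from its centre stay in the range of the chart.\<close>
  define T where "T = U \<inter> \<phi> -` ball (\<phi> x) e"
  have "open T"
    unfolding T_def using hom \<open>open U\<close>
    by (intro continuous_open_preimage) (auto simp: homeomorphism_def)
  have "f y = f x" if y: "y \<in> C" "y \<in> T" for y
  proof -
    define z where "z s = \<phi> x + s *\<^sub>R (\<phi> y - \<phi> x)" for s :: real
    have in_L: "\<phi> x \<in> L" "\<phi> y \<in> L"
      using equalityD1[OF slice] \<open>x \<in> C\<close> \<open>x \<in> U\<close> y unfolding T_def by auto
    have z_L: "z s \<in> L" for s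
      unfolding z_def using L in_L by (simp add: subspace_add subspace_diff subspace_scale)
    have \<psi>_C: "\<psi> (z s) \<in> C" if "z s \<in> V" for s
    proof -
      obtain c where "c \<in> C \<inter> U" "\<phi> c = z s"
        using slice z_L \<open>z s \<in> V\<close> by (metis IntI imageE)
      then show ?thesis
        using homeomorphism_apply1[OF hom] by (metis IntE)
    qed
    have z_V: "z s \<in> V" if "0 \<le> s" "s \<le> 1" for s
    proof -
      have "z s \<in> closed_segment (\<phi> x) (\<phi> y)"
        unfolding z_def in_segment using that
        by (intro exI[of _ s]) (simp add: scaleR_diff_left scaleR_diff_right)
      moreover have "closed_segment (\<phi> x) (\<phi> y) \<subseteq> ball (\<phi> x) e"
        using y \<open>e > 0\<close> unfolding T_def by (intro closed_segment_subset) auto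
      ultimately show ?thesis
        using e by blast
    qed
    have cont_z: "continuous_on UNIV z"
      unfolding z_def by (intro continuous_intros)
    then have "open (z -` V)"
      using \<open>open V\<close> by (simp add: continuous_on_open_vimage)
    have DERIV_0: "((\<lambda>s. f (\<psi> (z s))) has_real_derivative 0) (at s)" if "0 \<le> s" "s \<le> 1" for s
    proof -
      have zs: "z s \<in> V"
        using z_V that by blast
      obtain \<psi>' where \<psi>': "(\<psi> has_derivative \<psi>') (at (z s))"
        using \<psi>[OF zs] unfolding differentiable_def by blast
      have "(z has_vector_derivative (\<phi> y - \<phi> x)) (at s)"
        unfolding z_def by (auto intro!: derivative_eq_intros)
      from vector_derivative_diff_chain_within[OF this has_derivative_at_withinI[OF \<psi>']]
      have "(\<psi> \<circ> z has_vector_derivative \<psi>' (\<phi> y - \<phi> x)) (at s)" .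
      moreover have "(\<psi> \<circ> z) s \<in> critical_points M f"
        using \<psi>_C zs C(3) by auto
      moreover have "\<forall>\<^sub>F r in at s. (\<psi> \<circ> z) r \<in> M"
      proof -
        have "\<forall>\<^sub>F r in at s. r \<in> z -` V"
          using \<open>open (z -` V)\<close> zs by (intro eventually_at_in_open') auto
        then show ?thesis
          by eventually_elim (use \<psi>_C \<open>C \<subseteq> M\<close> in auto)
      qed
      ultimately have "((\<lambda>r. f ((\<psi> \<circ> z) r)) has_real_derivative 0) (at s)"
        by (rule critical_points_stationary_along_curve)
      then show ?thesis by simp
    qed
    have "f (\<psi> (z 1)) = f (\<psi> (z 0))"
    proof (rule DERIV_isconst_end[where f = "\<lambda>s. f (\<psi> (z s))" and a = 0 and b = 1])
      show "continuous_on {0..1} (\<lambda>s. f (\<psi> (z s)))"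
        by (intro continuous_at_imp_continuous_on ballI DERIV_isCont[OF DERIV_0]) auto
    qed (auto intro: DERIV_0)
    then show ?thesis
      using homeomorphism_apply1[OF hom] \<open>x \<in> U\<close> y unfolding z_def T_def by simp
  qed
  moreover have "openin (top_of_set C) (C \<inter> T)" "x \<in> C \<inter> T"
    using \<open>open T\<close> \<open>x \<in> C\<close> \<open>x \<in> U\<close> \<open>e > 0\<close> unfolding T_def by (auto simp: openin_open)
  ultimately show "\<exists>T. openin (top_of_set C) T \<and> x \<in> T \<and> (\<forall>y\<in>T. f y = f x)"
    by blast
qed

section \<open>Arcs from noncritical points of the sphere\<close>

lemma tangent_space_sphere_orthogonal:
  fixes x :: "'a::euclidean_space"
  assumes "x \<in> sphere 0 1" "v \<in> tangent_space (sphere 0 1) x"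
  shows "x \<bullet> v = 0"
proof -
  obtain \<gamma> where \<gamma>: "\<gamma> 0 = x" "\<forall>\<^sub>F t in at 0. \<gamma> t \<in> sphere 0 1"
      "(\<gamma> has_vector_derivative v) (at 0)"
    using tangent_spaceE[OF assms(2)] .
  have "((\<lambda>y. y \<bullet> y) has_derivative (\<lambda>h. 2 * (x \<bullet> h))) (at (\<gamma> 0) within sphere 0 1)"
    unfolding \<gamma>(1) by (auto intro!: derivative_eq_intros simp: inner_commute)
  from has_real_derivative_along_curve[OF this \<gamma>(3) _ \<gamma>(2)]
  have "((\<lambda>t. \<gamma> t \<bullet> \<gamma> t) has_real_derivative 2 * (x \<bullet> v)) (at 0)"
    using assms(1) \<gamma>(1) by simp
  moreover have "((\<lambda>t. \<gamma> t \<bullet> \<gamma> t) has_real_derivative 0) (at 0)"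
  proof -
    have "\<forall>\<^sub>F t in at 0. \<gamma> t \<bullet> \<gamma> t = 1"
      using \<gamma>(2) by eventually_elim (simp add: norm_eq_1)
    moreover have "\<gamma> 0 \<bullet> \<gamma> 0 = 1"
      using \<gamma>(1) assms(1) by (simp add: norm_eq_1)
    ultimately show ?thesis
      using has_field_derivative_cong_eventually[of "\<lambda>t. \<gamma> t \<bullet> \<gamma> t" "\<lambda>t. 1" 0 UNIV 0] by simp
  qed
  ultimately show ?thesis
    using DERIV_unique by force
qed

text \<open>
  A curve that witnesses a tangent vector need not be continuous away from its base point, and the
  connectedness arguments below need a continuous one.  Tangent vectors of the sphere are
  orthogonal to the base point, so each of them is also the velocity of a great circle.
\<close>

lemma descending_arc_from_noncritical_point:
  fixes f :: "'a::euclidean_space \<Rightarrow> real"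
  assumes f: "f differentiable_on sphere 0 1" and p: "p \<in> sphere 0 1"
    and noncrit: "p \<notin> critical_points (sphere 0 1) f"
  obtains q :: "real \<Rightarrow> 'a" where "continuous_on {0..1} q" "q 0 = p"
    "q ` {0..1} \<subseteq> sphere 0 1" "\<forall>t\<in>{0<..1}. f (q t) < f p"
proof -
  obtain f' where f': "(f has_derivative f') (at p within sphere 0 1)"
    using f p unfolding differentiable_on_def differentiable_def by blast
  interpret f': linear f'
    using has_derivative_linear[OF f'] .
  obtain v where v: "v \<in> tangent_space (sphere 0 1) p" "f' v \<noteq> 0"
    using noncrit f' p unfolding critical_points_def by blast
  have "v \<noteq> 0"
    using v(2) f'.zero by auto
  \<comment> \<open>Normalized, and reversed if necessary, so that \<open>f\<close> decreases in the direction \<open>w\<close>.\<close>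
  define w where "w = (- sgn (f' v) / norm v) *\<^sub>R v"
  have "norm w = 1"
    using v(2) \<open>v \<noteq> 0\<close> unfolding w_def by (simp add: abs_sgn_eq)
  have "p \<bullet> w = 0"
    using tangent_space_sphere_orthogonal[OF p v(1)] unfolding w_def by simp
  have "f' w = - \<bar>f' v\<bar> / norm v"
    unfolding w_def f'.scale by (simp add: abs_sgn mult.commute)
  then have "f' w < 0"
    using v(2) \<open>v \<noteq> 0\<close> by simp
  define c where "c t = cos t *\<^sub>R p + sin t *\<^sub>R w" for t
  have c_sphere: "c t \<in> sphere 0 1" for t
  proof -
    have "p \<bullet> p = 1" "w \<bullet> w = 1"
      using p \<open>norm w = 1\<close> by (simp_all add: norm_eq_1)
    then have "c t \<bullet> c t = (cos t)\<^sup>2 + (sin t)\<^sup>2"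
      unfolding c_def using \<open>p \<bullet> w = 0\<close>
      by (simp add: inner_add_left inner_add_right inner_commute power2_eq_square)
    then show ?thesis
      by (simp add: norm_eq_1)
  qed
  have [simp]: "c 0 = p"
    unfolding c_def by simp
  have "(c has_vector_derivative w) (at 0)"
    unfolding c_def by (auto intro!: derivative_eq_intros)
  then have "((\<lambda>t. f (c t)) has_real_derivative f' w) (at 0)"
    using has_real_derivative_along_curve[of f f' c 0 "sphere 0 1" w] f' c_sphere p by simp
  from DERIV_neg_dec_right[OF this \<open>f' w < 0\<close>]
  obtain d where "d > 0" and d: "\<And>h. 0 < h \<Longrightarrow> h < d \<Longrightarrow> f (c h) < f p"
    by auto
  show ?thesis
  proof (rule that[of "\<lambda>t. c (t * (d / 2))"])
    show "continuous_on {0..1} (\<lambda>t. c (t * (d / 2)))"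
      unfolding c_def by (intro continuous_intros)
    show "\<forall>t\<in>{0<..1}. f (c (t * (d / 2))) < f p"
    proof
      fix t :: real assume "t \<in> {0<..1}"
      then have "0 < t" "t \<le> 1" by simp_all
      then have "t * (d / 2) \<le> 1 * (d / 2)"
        using \<open>d > 0\<close> by (intro mult_right_mono) auto
      with \<open>0 < t\<close> \<open>d > 0\<close> show "f (c (t * (d / 2))) < f p"
        by (intro d) auto
    qed
  qed (use c_sphere in auto)
qed

lemma ascending_arc_from_noncritical_point:
  fixes f :: "'a::euclidean_space \<Rightarrow> real"
  assumes f: "f differentiable_on sphere 0 1" and p: "p \<in> sphere 0 1"
    and noncrit: "p \<notin> critical_points (sphere 0 1) f"
  obtains q :: "real \<Rightarrow> 'a" where "continuous_on {0..1} q" "q 0 = p"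
    "q ` {0..1} \<subseteq> sphere 0 1" "\<forall>t\<in>{0<..1}. f p < f (q t)"
proof -
  have "(\<lambda>x. - f x) differentiable_on sphere 0 1"
    using f by (rule differentiable_on_minus)
  moreover have "p \<notin> critical_points (sphere 0 1) (\<lambda>x. - f x)"
    using noncrit by (simp add: critical_points_uminus)
  ultimately obtain q :: "real \<Rightarrow> 'a" where "continuous_on {0..1} q" "q 0 = p"
      "q ` {0..1} \<subseteq> sphere 0 1" "\<forall>t\<in>{0<..1}. - f (q t) < - f p"
    using descending_arc_from_noncritical_point[OF _ p] by metis
  then show thesis
    by (intro that) simp_all
qed

section \<open>Complementary components and separation\<close>

lemma complementary_component_openin:
  assumes "locally connected M" "closed C" "A \<in> components (M - C)"
  shows "openin (top_of_set M) A"
proof -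
  have "openin (top_of_set M) (M \<inter> - C)"
    using assms(2) by (simp add: openin_open_Int open_Compl)
  then show ?thesis
    using assms(1,3) unfolding locally_connected_open_component Diff_eq by blast
qed

lemma complementary_component_closure:
  assumes "closed M" "A \<in> components (M - C)"
  shows "closure A \<subseteq> A \<union> C"
proof -
  obtain T where "closed T" "A = (M - C) \<inter> T"
    using closedin_component[OF assms(2)] unfolding closedin_closed by blast
  moreover from this have "closure A \<subseteq> M" "closure A \<subseteq> T"
    using assms(1) by (intro closure_minimal; blast)+
  ultimately show ?thesis
    by blast
qed

lemma complementary_component_Un_connected:
  fixes M C A :: "'a::metric_space set"
  assumes "connected M" "locally connected M" "closed C" "connected C" "C \<subseteq> M"
    and A: "A \<in> components (M - C)"
  shows "connected (A \<union> C)"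
proof -
  have "openin (top_of_set M) A"
    using assms complementary_component_openin by blast
  then have "openin (top_of_set (M - C)) A"
    using in_components_subset[OF A] by (rule openin_subset_trans) auto
  from connected_Un_clopen_in_complement[OF assms(4,1,5) this closedin_component[OF A]]
  show ?thesis
    by (simp add: Un_commute)
qed

text \<open>
  The point \<open>p\<close> selects the sides of the separating sets \<open>C\<close> and \<open>D\<close>: a component that avoids \<open>p\<close>
  lies on the far side.  Since \<open>C\<close> is connected, so is the near side \<open>M - A\<close>, and it does not
  meet \<open>D\<close>.  If \<open>B\<close> met it, then \<open>B\<close> would contain all of it, and hence \<open>p\<close>.
\<close>

lemma component_nested:
  fixes M C A :: "'a::metric_space set"
  assumes "connected M" "connected C" "C \<subseteq> M" "A \<in> components (M - C)" "p \<in> M" "p \<notin> A"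
    and "B \<in> components (M - D)" "p \<notin> B" "D \<subseteq> A"
  shows "B \<subseteq> A"
proof (rule ccontr)
  assume "\<not> B \<subseteq> A"
  moreover have "B \<subseteq> M - D"
    using assms(7) by (rule in_components_subset)
  ultimately have "B \<inter> (M - A) \<noteq> {}"
    by blast
  moreover have "connected (M - A)"
    using assms component_diff_connected by blast
  ultimately have "M - A \<subseteq> B"
    using assms(9) by (intro components_maximal[OF assms(7)]) auto
  with assms show False by blast
qed

lemma clopen_contains_component:
  assumes "openin (top_of_set U) A" "closedin (top_of_set U) A" "A \<noteq> {}"
  obtains B where "B \<in> components U" "B \<subseteq> A"
proof -
  obtain a where "a \<in> A" using assms(3) by blast
  have "A \<subseteq> U"
    using openin_subset[OF assms(1)] by simp
  then have "a \<in> U"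
    using \<open>a \<in> A\<close> by blast
  define B where "B = connected_component_set U a"
  have B: "B \<in> components U" "a \<in> B" "connected B" "B \<subseteq> U"
    unfolding B_def using \<open>a \<in> U\<close> by (auto simp: componentsI connected_component_subset)
  have "openin (top_of_set B) (B \<inter> A)"
  proof -
    obtain T where "open T" "A = U \<inter> T"
      using assms(1) unfolding openin_open by blast
    moreover have "B \<inter> (U \<inter> T) = B \<inter> T"
      using B(4) by blast
    ultimately show ?thesis
      by (simp add: openin_open_Int)
  qed
  moreover have "closedin (top_of_set B) (B \<inter> A)"
  proof -
    obtain T where "closed T" "A = U \<inter> T"
      using assms(2) unfolding closedin_closed by blast
    moreover have "B \<inter> (U \<inter> T) = B \<inter> T"
      using B(4) by blast
    ultimately show ?thesis
      by (simp add: closedin_closed_Int)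
  qed
  ultimately have "B \<inter> A = {} \<or> B \<inter> A = B"
    using B(3) unfolding connected_clopen by blast
  then show thesis
    using \<open>a \<in> A\<close> B that by blast
qed

text \<open>
  Stereographic projection from \<open>p\<close> carries \<open>C\<close> to an embedded sphere of codimension one in a
  Euclidean space of dimension at least two, whose complement is disconnected by Jordan-Brouwer
  and therefore has a bounded component.  The preimage of that component stays away from \<open>p\<close>, so it
  is relatively clopen in the complement of \<open>C\<close> in the whole sphere, not only in the punctured one.
\<close>

lemma sphere_complement_has_component_avoiding_point:
  fixes C :: "'a::euclidean_space set"
  assumes dim: "DIM('a) = DIM('b::euclidean_space) + 1" "2 \<le> DIM('b)"
    and C: "C \<subseteq> sphere 0 1" "C homeomorphic sphere (0::'b) 1"
    and p: "p \<in> sphere 0 1" "p \<notin> C"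
  obtains A where "A \<in> components (sphere 0 1 - C)" "p \<notin> A"
proof -
  let ?S = "sphere (0::'a) 1"
  have "?S - {p} homeomorphic (UNIV :: 'b set)"
    using homeomorphic_punctured_sphere_affine_gen[of "cball (0::'a) 1" p "UNIV :: 'b set"] p dim(1)
    by (simp add: aff_dim_cball)
  then obtain h g where hom: "homeomorphism (?S - {p}) (UNIV :: 'b set) h g"
    unfolding homeomorphic_def by blast
  then have hom': "homeomorphism UNIV (?S - {p}) g h"
    by (rule homeomorphism_symD)
  have "C \<subseteq> ?S - {p}"
    using C p by blast
  then have homC: "homeomorphism C (h ` C) h g"
    using homeomorphism_of_subsets[OF hom] by blast
  then have hC: "h ` C homeomorphic sphere (0::'b) 1"
    using C(2) homeomorphic_sym homeomorphic_trans homeomorphic_def by metis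
  then have "compact (h ` C)"
    using homeomorphic_compactness compact_sphere by blast
  have "\<not> connected (- h ` C)"
    using Jordan_Brouwer_separation[OF hC] by simp
  then obtain B where B: "B \<in> components (- h ` C)" "bounded B"
    using cobounded_has_bounded_component[of "- h ` C"] dim(2) \<open>compact (h ` C)\<close> compact_imp_bounded
    by auto
  have "open B"
    using B(1) \<open>compact (h ` C)\<close> by (meson compact_imp_closed open_Compl open_components)
  have gB: "g ` B \<subseteq> ?S - C" "p \<notin> g ` B"
  proof -
    have "g b \<in> ?S - {p}" for b
      using homeomorphism_image1[OF hom'] by blast
    moreover have "g b \<notin> C" if "b \<in> B" for b
    proof
      assume "g b \<in> C"
      then have "h (g b) \<in> h ` C" by blast
      moreover have "h (g b) = b"
        using homeomorphism_apply1[OF hom'] by blast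
      ultimately show False
        using that in_components_subset[OF B(1)] by auto
    qed
    ultimately show "g ` B \<subseteq> ?S - C" "p \<notin> g ` B" by blast+
  qed
  have "openin (top_of_set (?S - {p})) (g ` B)"
    using homeomorphism_imp_open_map[OF hom'] \<open>open B\<close> by simp
  then have "openin (top_of_set ?S) (g ` B)"
    using openin_trans openin_delete openin_subtopology_self by blast
  then have opn: "openin (top_of_set (?S - C)) (g ` B)"
    using gB(1) by (rule openin_subset_trans) auto
  have "closure B \<subseteq> B \<union> h ` C"
    using complementary_component_closure[of UNIV B "h ` C"] B(1) by (simp add: Compl_eq_Diff_UNIV)
  then have "g ` closure B \<subseteq> g ` B \<union> C"
    using homeomorphism_apply1[OF hom] \<open>C \<subseteq> ?S - {p}\<close> by force
  moreover have "compact (g ` closure B)"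
    using B(2) homeomorphism_cont1[OF hom'] compact_continuous_image
    by (metis compact_closure continuous_on_subset subset_UNIV)
  moreover have "g ` B \<subseteq> g ` closure B"
    using closure_subset by blast
  ultimately have "closedin (top_of_set (?S - C)) (g ` B)"
    unfolding closedin_closed using gB compact_imp_closed
    by (intro exI[of _ "g ` closure B"]) blast
  with opn obtain A where "A \<in> components (?S - C)" "A \<subseteq> g ` B"
    using clopen_contains_component in_components_nonempty[OF B(1)] by blast
  with gB that show thesis
    by blast
qed

lemma chain_compact_Inter_nonempty:
  fixes \<K> :: "'a::t2_space set set"
  assumes "\<K> \<noteq> {}" and chain: "subset.chain UNIV \<K>"
    and K: "\<And>K. K \<in> \<K> \<Longrightarrow> compact K \<and> K \<noteq> {}"
  shows "\<Inter>\<K> \<noteq> {}"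
proof -
  obtain K0 where "K0 \<in> \<K>"
    using assms(1) by blast
  have "K0 \<inter> \<Inter>\<K> \<noteq> {}"
  proof (rule compact_imp_fip)
    fix F assume F: "finite F" "F \<subseteq> \<K>"
    have "\<exists>K\<in>\<K>. K \<subseteq> K0 \<inter> \<Inter>F"
      using F
    proof (induction F)
      case empty
      then show ?case using \<open>K0 \<in> \<K>\<close> by auto
    next
      case (insert L F)
      then obtain K where "K \<in> \<K>" "K \<subseteq> K0 \<inter> \<Inter>F" "L \<in> \<K>" by blast
      then have "K \<subseteq> L \<or> L \<subseteq> K"
        using chain unfolding subset_chain_def by blast
      then have "K \<subseteq> K0 \<inter> \<Inter>(insert L F) \<or> L \<subseteq> K0 \<inter> \<Inter>(insert L F)"
        using \<open>K \<subseteq> K0 \<inter> \<Inter>F\<close> by blast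
      then show ?case
        using \<open>K \<in> \<K>\<close> \<open>L \<in> \<K>\<close> by blast
    qed
    then show "K0 \<inter> \<Inter>F \<noteq> {}"
      using K by blast
  qed (use K \<open>K0 \<in> \<K>\<close> compact_imp_closed in auto)
  then show ?thesis by blast
qed

section \<open>Descent through nested regions\<close>

text \<open>
  All that the descent uses about the components of the critical set.  The base point \<open>p\<close>
  distinguishes the near side of a critical component from the far ones, those that avoid \<open>p\<close>.
  Without it, a critical component inside a region might select a side that sticks out of the
  region.
\<close>

locale critical_components_separate =
  fixes f :: "'a::euclidean_space \<Rightarrow> real" and p :: 'a
  assumes dim: "2 \<le> DIM('a)"
    and diff: "f differentiable_on sphere 0 1"
    and p_sphere: "p \<in> sphere 0 1"
    and closed_crit: "C \<in> components (critical_points (sphere 0 1) f) \<Longrightarrow> closed C"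
    and const_crit: "C \<in> components (critical_points (sphere 0 1) f) \<Longrightarrow> f constant_on C"
    and avoid: "C \<in> components (critical_points (sphere 0 1) f) \<Longrightarrow> p \<notin> C
      \<Longrightarrow> \<exists>A\<in>components (sphere 0 1 - C). p \<notin> A"
begin

abbreviation "S \<equiv> sphere (0::'a) 1"
abbreviation "Z \<equiv> critical_points S f"

text \<open>
  The far sides of the critical components.  A critical component through \<open>p\<close> contributes all
  components of its complement; the descent may start from one of these.
\<close>

definition regions :: "'a set set" where
  "regions = {A. p \<notin> A \<and> (\<exists>C\<in>components Z. A \<in> components (S - C))}"

lemma connected_S: "connected S"
  using dim by (simp add: connected_sphere_eq)

lemma Z_subset_S: "Z \<subseteq> S"
  unfolding critical_points_def by blast

lemma continuous_f: "continuous_on S f"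
  using diff by (rule differentiable_imp_continuous_on)

lemma regionE:
  assumes "A \<in> regions"
  obtains C c where "p \<notin> A" "C \<in> components Z" "A \<in> components (S - C)" "C \<subseteq> S" "C \<inter> A = {}"
    "\<And>x. x \<in> C \<Longrightarrow> f x = c"
proof -
  obtain C where C: "p \<notin> A" "C \<in> components Z" "A \<in> components (S - C)"
    using assms unfolding regions_def by blast
  moreover obtain c where "\<And>x. x \<in> C \<Longrightarrow> f x = c"
    using const_crit[OF C(2)] unfolding constant_on_def by blast
  moreover have "C \<subseteq> S" "C \<inter> A = {}"
    using in_components_subset[OF C(2)] in_components_subset[OF C(3)] Z_subset_S by blast+
  ultimately show thesis
    using that by blast
qed

lemma region_nonempty: "A \<in> regions \<Longrightarrow> A \<noteq> {}"
  unfolding regions_def using in_components_nonempty by blast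

lemma region_subset_S: "A \<in> regions \<Longrightarrow> A \<subseteq> S"
  unfolding regions_def using in_components_subset by blast

lemma region_closure:
  assumes "A \<in> regions"
  shows "closure A \<subseteq> S" "compact (closure A)"
proof -
  show "closure A \<subseteq> S"
    using region_subset_S[OF assms] by (simp add: closure_minimal)
  then show "compact (closure A)"
    using bounded_subset[OF bounded_sphere] by (simp add: compact_eq_bounded_closed)
qed

lemma region_openin:
  assumes "A \<in> regions"
  shows "openin (top_of_set S) A"
proof -
  obtain C where "C \<in> components Z" "A \<in> components (S - C)"
    using regionE[OF assms] by metis
  then show ?thesis
    using complementary_component_openin[OF locally_connected_sphere] closed_crit by blast
qed

text \<open>
  Distinct nested regions are bounded by distinct critical components, and these are disjoint.  So
  the inner region stays away from the boundary of the outer one.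
\<close>

lemma region_closure_subset:
  assumes "A \<in> regions" "B \<in> regions" "B \<subset> A"
  shows "closure B \<subseteq> A"
proof -
  obtain C where C: "C \<in> components Z" "A \<in> components (S - C)" "C \<inter> A = {}"
    using regionE[OF assms(1)] by metis
  obtain D where D: "D \<in> components Z" "B \<in> components (S - D)" "D \<subseteq> S"
    using regionE[OF assms(2)] by metis
  have ne: "B \<noteq> {}"
    using region_nonempty assms(2) .
  have "C \<noteq> D"
    using components_nonoverlap[of A "S - C" B] C D assms(3) ne by blast
  then have "C \<inter> D = {}"
    using components_nonoverlap C(1) D(1) by blast
  then have "B \<union> D \<subseteq> S - C"
    using C(3) D assms region_subset_S by blast
  moreover have "connected (B \<union> D)"
    using D closed_crit in_components_connected connected_S locally_connected_sphere
    by (intro complementary_component_Un_connected) blast+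
  ultimately have "B \<union> D \<subseteq> A"
    using ne assms(3) by (intro components_maximal[OF C(2)]) blast+
  then show ?thesis
    using complementary_component_closure[OF closed_sphere D(2)] by blast
qed

text \<open>
  This is the argument of Rolle's theorem: the function is constant on the boundary of a region, so
  it has an extremum in the interior.
\<close>

lemma critical_point_in_region:
  assumes A: "A \<in> regions"
  shows "A \<inter> Z \<noteq> {}"
proof -
  obtain C c where C: "A \<in> components (S - C)" "\<And>x. x \<in> C \<Longrightarrow> f x = c"
    using regionE[OF A] by metis
  have clo: "closure A \<subseteq> A \<union> C"
    using complementary_component_closure[OF closed_sphere C(1)] .
  have ne: "closure A \<noteq> {}"
    using region_nonempty[OF A] by simp
  have cont: "continuous_on (closure A) f"
    using continuous_f region_closure(1)[OF A] by (rule continuous_on_subset)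
  obtain x where x: "x \<in> closure A" "\<And>y. y \<in> closure A \<Longrightarrow> f x \<le> f y"
    using continuous_attains_inf[OF region_closure(2)[OF A] ne cont] by blast
  obtain z where z: "z \<in> closure A" "\<And>y. y \<in> closure A \<Longrightarrow> f y \<le> f z"
    using continuous_attains_sup[OF region_closure(2)[OF A] ne cont] by blast
  have in_clo: "y \<in> closure A" if "y \<in> A" for y
    using that closure_subset by blast
  consider "x \<in> A" | "z \<in> A" | "x \<in> C" "z \<in> C"
    using x(1) z(1) clo by blast
  then show ?thesis
  proof cases
    case 1
    then have "x \<in> Z"
      using local_minimum_critical[OF diff region_openin[OF A]] x(2) in_clo by blast
    with 1 show ?thesis by blast
  next
    case 2
    then have "z \<in> Z"
      using local_maximum_critical[OF diff region_openin[OF A]] z(2) in_clo by blast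
    with 2 show ?thesis by blast
  next
    case 3
    have const: "f y = c" if "y \<in> A" for y
      using x(2)[of y] z(2)[of y] C(2)[OF 3(1)] C(2)[OF 3(2)] in_clo[OF that] by simp
    obtain a where "a \<in> A"
      using region_nonempty[OF A] by blast
    then have "a \<in> Z"
      using local_minimum_critical[OF diff region_openin[OF A], of a] const by simp
    with \<open>a \<in> A\<close> show ?thesis by blast
  qed
qed

lemma arc_stays_in_region:
  fixes q :: "real \<Rightarrow> 'a"
  assumes A: "A \<in> components (S - C)" "C \<inter> A = {}"
    and q: "continuous_on {0..1} q" "q ` {0..1} \<subseteq> S" "q 0 \<in> A"
    and avoid: "\<And>t. 0 < t \<Longrightarrow> t \<le> 1 \<Longrightarrow> q t \<notin> C"
  shows "q 1 \<in> A"
proof -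
  have "q t \<notin> C" if "t \<in> {0..1}" for t
    using avoid[of t] q(3) A(2) that by (cases "t = 0") auto
  then have "q ` {0..1} \<subseteq> S - C"
    using q(2) by blast
  moreover have "connected (q ` {0..1})"
    using q(1) by (intro connected_continuous_image) auto
  moreover have "q 0 \<in> q ` {0..1}" "q 1 \<in> q ` {0..1}"
    by simp_all
  ultimately show ?thesis
    using components_maximal[OF A(1), of "q ` {0..1}"] q(3) by blast
qed

text \<open>
  If the chain has a least region, then that region contains a critical point.  Otherwise the
  intersection \<open>K\<close> is also the intersection of the closures, hence compact and nonempty, and the
  function attains a minimum over \<open>K\<close> at some \<open>x\<close> and a maximum at some \<open>z\<close>.  If neither is
  critical, then there are an arc \<open>q\<close> from \<open>x\<close> along which the function drops below its minimum over
  \<open>K\<close>, and an arc \<open>r\<close> from \<open>z\<close> along which it rises above its maximum.  To leave a region of the chain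
  an arc has to cross the boundary, where the function has a single value.  This value cannot lie
  both below \<open>f x\<close> and above \<open>f z\<close>, so at least one of the two arcs is trapped in the region.  As the
  regions are nested, one of the two arcs is trapped in all of them and thus ends in \<open>K\<close>,
  although the value of \<open>f\<close> at its end is not attained there.
\<close>

lemma critical_point_in_chain:
  assumes "\<W> \<noteq> {}" and chain: "subset.chain regions \<W>"
  shows "\<Inter>\<W> \<inter> Z \<noteq> {}"
proof (cases "\<exists>A\<in>\<W>. \<forall>B\<in>\<W>. A \<subseteq> B")
  case True
  then obtain A where "A \<in> \<W>" "\<Inter>\<W> = A" by blast
  then show ?thesis
    using critical_point_in_region chain unfolding subset_chain_def by blast
next
  case False
  have reg: "\<And>A. A \<in> \<W> \<Longrightarrow> A \<in> regions" and tot: "\<And>A B. A \<in> \<W> \<Longrightarrow> B \<in> \<W> \<Longrightarrow> A \<subseteq> B \<or> B \<subseteq> A"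
    using chain unfolding subset_chain_def by blast+
  have smaller: "\<exists>B\<in>\<W>. closure B \<subseteq> A" if "A \<in> \<W>" for A
  proof -
    obtain B where "B \<in> \<W>" "\<not> A \<subseteq> B"
      using False \<open>A \<in> \<W>\<close> by blast
    then have "B \<subset> A"
      using tot \<open>A \<in> \<W>\<close> by blast
    then show ?thesis
      using region_closure_subset reg \<open>A \<in> \<W>\<close> \<open>B \<in> \<W>\<close> by blast
  qed
  define K where "K = \<Inter>\<W>"
  have K: "K = \<Inter>(closure ` \<W>)"
  proof (rule equalityI)
    show "K \<subseteq> \<Inter>(closure ` \<W>)"
    proof (rule INT_greatest)
      show "K \<subseteq> closure A" if "A \<in> \<W>" for A
        using that closure_subset[of A] unfolding K_def by blast
    qed
    show "\<Inter>(closure ` \<W>) \<subseteq> K"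
      unfolding K_def
    proof (rule Inter_greatest)
      show "\<Inter>(closure ` \<W>) \<subseteq> A" if "A \<in> \<W>" for A
        using smaller[OF that] by blast
    qed
  qed
  have "K \<noteq> {}"
    unfolding K
  proof (rule chain_compact_Inter_nonempty)
    show "subset.chain UNIV (closure ` \<W>)"
    proof -
      have "closure A \<subseteq> closure B \<or> closure B \<subseteq> closure A" if "A \<in> \<W>" "B \<in> \<W>" for A B
        using tot[OF that] closure_mono by metis
      then show ?thesis
        unfolding subset_chain_def by auto
    qed
  qed (use assms(1) region_closure(2) region_nonempty reg in auto)
  have "K \<subseteq> S"
    using assms(1) region_subset_S reg unfolding K_def by blast
  have "closed K"
    unfolding K by (intro closed_INT ballI closed_closure)
  then have "compact K"
    using \<open>K \<subseteq> S\<close> bounded_subset[OF bounded_sphere] by (simp add: compact_eq_bounded_closed)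
  have cont: "continuous_on K f"
    using continuous_f \<open>K \<subseteq> S\<close> by (rule continuous_on_subset)
  obtain x where x: "x \<in> K" "\<And>y. y \<in> K \<Longrightarrow> f x \<le> f y"
    using continuous_attains_inf[OF \<open>compact K\<close> \<open>K \<noteq> {}\<close> cont] by blast
  obtain z where z: "z \<in> K" "\<And>y. y \<in> K \<Longrightarrow> f y \<le> f z"
    using continuous_attains_sup[OF \<open>compact K\<close> \<open>K \<noteq> {}\<close> cont] by blast
  show ?thesis
  proof (rule ccontr)
    assume "\<not> \<Inter>\<W> \<inter> Z \<noteq> {}"
    then have noncrit: "x \<notin> Z" "z \<notin> Z"
      using x(1) z(1) unfolding K_def by blast+
    have in_S: "x \<in> S" "z \<in> S"
      using x(1) z(1) \<open>K \<subseteq> S\<close> by blast+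
    obtain q :: "real \<Rightarrow> 'a" where q: "continuous_on {0..1} q" "q 0 = x" "q ` {0..1} \<subseteq> S"
        "\<forall>t\<in>{0<..1}. f (q t) < f x"
      using descending_arc_from_noncritical_point[OF diff in_S(1) noncrit(1)] .
    obtain r :: "real \<Rightarrow> 'a" where r: "continuous_on {0..1} r" "r 0 = z" "r ` {0..1} \<subseteq> S"
        "\<forall>t\<in>{0<..1}. f z < f (r t)"
      using ascending_arc_from_noncritical_point[OF diff in_S(2) noncrit(2)] .
    have dichotomy: "q 1 \<in> A \<or> r 1 \<in> A" if AW: "A \<in> \<W>" for A
    proof -
      obtain C c where C: "A \<in> components (S - C)" "C \<inter> A = {}" "\<And>y. y \<in> C \<Longrightarrow> f y = c"
        using regionE[OF reg[OF AW]] by metis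
      have "x \<in> A" "z \<in> A"
        using x(1) z(1) AW unfolding K_def by blast+
      have "f x \<le> f z"
        using x(2) z(1) .
      then consider "f x \<le> c" | "c \<le> f z" by linarith
      then show ?thesis
      proof cases
        case 1
        have "q t \<notin> C" if "0 < t" "t \<le> 1" for t
          using q(4) that C(3)[of "q t"] 1 by force
        then show ?thesis
          using arc_stays_in_region[OF C(1,2) q(1,3)] q(2) \<open>x \<in> A\<close> by simp
      next
        case 2
        have "r t \<notin> C" if "0 < t" "t \<le> 1" for t
          using r(4) that C(3)[of "r t"] 2 by force
        then show ?thesis
          using arc_stays_in_region[OF C(1,2) r(1,3)] r(2) \<open>z \<in> A\<close> by simp
      qed
    qed
    have "q 1 \<in> K \<or> r 1 \<in> K"
    proof (rule ccontr)
      assume "\<not> ?thesis"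
      then obtain A B where "A \<in> \<W>" "q 1 \<notin> A" "B \<in> \<W>" "r 1 \<notin> B"
        unfolding K_def by blast
      with tot[of A B] dichotomy[of A] dichotomy[of B] show False by blast
    qed
    moreover have "f (q 1) < f x" "f z < f (r 1)"
      using q(4) r(4) by simp_all
    ultimately show False
      using x(2)[of "q 1"] z(2)[of "r 1"] by linarith
  qed
qed

text \<open>
  The critical component of \<open>x\<close> is disjoint from the boundaries of all regions in \<open>\<W>\<close>, so it lies
  inside each of them, and so do its far sides.
\<close>

lemma region_inside_critical_point:
  assumes "\<W> \<noteq> {}" and W: "\<W> \<subseteq> regions" and x: "x \<in> \<Inter>\<W>" "x \<in> Z"
  obtains B where "B \<in> regions" "\<And>A. A \<in> \<W> \<Longrightarrow> B \<subset> A"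
proof -
  define C where "C = connected_component_set Z x"
  have C: "C \<in> components Z" "x \<in> C" "connected C"
    unfolding C_def using x(2) by (auto simp: componentsI)
  have C_S: "C \<subseteq> S"
    using in_components_subset[OF C(1)] Z_subset_S by blast
  have inside: "C \<subseteq> A" if AW: "A \<in> \<W>" for A
  proof -
    obtain D where D: "D \<in> components Z" "A \<in> components (S - D)" "D \<inter> A = {}"
      using regionE[OF subsetD[OF W AW]] by metis
    have "x \<in> A"
      using x(1) AW by blast
    then have "C \<inter> D = {}"
      using D(3) C components_nonoverlap[OF C(1) D(1)] by blast
    then show ?thesis
      using C C_S \<open>x \<in> A\<close> by (intro components_maximal[OF D(2)]) blast+
  qed
  have p_notin: "p \<notin> A" if "A \<in> \<W>" for A
    using that W unfolding regions_def by blast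
  then have "p \<notin> C"
    using inside assms(1) by blast
  then obtain B where B: "B \<in> components (S - C)" "p \<notin> B"
    using avoid[OF C(1)] by blast
  have "B \<subset> A" if AW: "A \<in> \<W>" for A
  proof -
    obtain D where D: "D \<in> components Z" "A \<in> components (S - D)" "D \<subseteq> S"
      using regionE[OF subsetD[OF W AW]] by metis
    have "B \<subseteq> A"
      using component_nested[OF connected_S in_components_connected[OF D(1)] D(3,2) p_sphere
          p_notin[OF AW] B inside[OF AW]] .
    moreover have "x \<in> A" "x \<notin> B"
      using x(1) AW C(2) in_components_subset[OF B(1)] by blast+
    ultimately show ?thesis by blast
  qed
  moreover have "B \<in> regions"
    unfolding regions_def using B C(1) by blast
  ultimately show thesis
    using that by blast
qed

text \<open>
  A maximal chain of regions would have a critical point in its intersection, and a far side of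
  the critical component of that point would extend the chain.
\<close>

lemma regions_empty: "regions = {}"
proof (rule ccontr)
  assume "regions \<noteq> {}"
  obtain \<W> where max: "subset.maxchain regions \<W>"
    using subset.Hausdorff by blast
  then have chain: "subset.chain regions \<W>"
    by (rule subset.maxchain_imp_chain)
  have extend: "A \<in> \<W>" if "A \<in> regions" "\<And>B. B \<in> \<W> \<Longrightarrow> A \<subseteq> B" for A
  proof (rule ccontr)
    assume "A \<notin> \<W>"
    moreover have "subset.chain regions (insert A \<W>)"
      using chain that unfolding subset_chain_def by blast
    ultimately show False
      using max unfolding subset.maxchain_def by blast
  qed
  have "\<W> \<noteq> {}"
    using extend \<open>regions \<noteq> {}\<close> by blast
  then obtain x where "x \<in> \<Inter>\<W>" "x \<in> Z"
    using critical_point_in_chain[OF _ chain] by blast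
  then obtain B where "B \<in> regions" "\<And>A. A \<in> \<W> \<Longrightarrow> B \<subset> A"
    using region_inside_critical_point[OF \<open>\<W> \<noteq> {}\<close>] chain unfolding subset_chain_def by metis
  then show False
    using extend[of B] by blast
qed

end

section \<open>No P-functions on the sphere\<close>

theorem theorem3p5:
  fixes n :: nat
  assumes "n \<ge> 1"
    and "DIM('a::euclidean_space) = n + 1"
    and "DIM('b::euclidean_space) = n"
  shows "\<not> (\<exists>f :: 'a \<Rightarrow> real. P_function (sphere (0::'b) 1) (sphere (0::'a) 1) f)"
proof
  let ?S = "sphere (0::'a) 1"
  assume "\<exists>f :: 'a \<Rightarrow> real. P_function (sphere (0::'b) 1) ?S f"
  then obtain f :: "'a \<Rightarrow> real" where "P_function (sphere (0::'b) 1) ?S f" ..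
  then have diff: "f differentiable_on ?S"
    and C: "\<And>C. C \<in> components (critical_points ?S f) \<Longrightarrow>
      (\<exists>k. smooth_submanifold k C) \<and> C homeomorphic sphere (0::'b) 1"
    unfolding P_function_def by blast+
  have sub: "C \<subseteq> ?S" if "C \<in> components (critical_points ?S f)" for C
    using in_components_subset[OF that] unfolding critical_points_def by blast
  have "continuous_on ?S f"
    using diff by (rule differentiable_imp_continuous_on)
  moreover have "?S \<noteq> {}"
    by simp
  ultimately obtain x where x: "x \<in> ?S" "\<And>y. y \<in> ?S \<Longrightarrow> f x \<le> f y"
    using continuous_attains_inf[OF compact_sphere] by blast
  have "x \<in> critical_points ?S f"
    using local_minimum_critical[OF diff _ x(1)] x(2) by simp
  then obtain C0 where C0: "C0 \<in> components (critical_points ?S f)"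
    using componentsI by blast
  \<comment> \<open>This settles \<open>n = 1\<close>: the two points of the zero-sphere are not connected.\<close>
  have "connected (sphere (0::'b) 1)"
    using C[OF C0] in_components_connected[OF C0] homeomorphic_connectedness by blast
  then have dim_b: "2 \<le> DIM('b)"
    by (simp add: connected_sphere_eq)
  \<comment> \<open>So that there is a base point \<open>p\<close> off \<open>C0\<close>, and \<open>C0\<close> has a far side to start from.\<close>
  have "C0 \<noteq> ?S"
  proof
    assume "C0 = ?S"
    then obtain g h where "homeomorphism ?S (sphere (0::'b) 1) g h"
      using C[OF C0] unfolding homeomorphic_def by blast
    then have "continuous_on ?S g" "inj_on g ?S"
      by (auto simp: homeomorphism_def intro: inj_on_inverseI)
    then have "DIM('a) \<le> DIM('b)"
      using no_embedding_sphere_lowdim by force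
    with assms show False by simp
  qed
  then obtain p where p: "p \<in> ?S" "p \<notin> C0"
    using sub[OF C0] by blast
  have avoid: "\<exists>A\<in>components (?S - C). p \<notin> A"
    if "C \<in> components (critical_points ?S f)" "p \<notin> C" for C
    using sphere_complement_has_component_avoiding_point[where 'b = 'b, of C p]
      sub[OF that(1)] C[OF that(1)] p(1) that(2) dim_b assms(2,3) by metis
  interpret critical_components_separate f p
  proof
    fix C' assume C': "C' \<in> components (critical_points ?S f)"
    show "closed C'"
      using C[OF C'] homeomorphic_compactness compact_sphere compact_imp_closed by blast
    show "f constant_on C'"
      using C[OF C'] in_components_connected[OF C'] in_components_subset[OF C']
        constant_on_connected_critical_submanifold by blast
  qed (use assms diff p avoid in auto)
  obtain A where "A \<in> components (?S - C0)" "p \<notin> A"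
    using avoid[OF C0 p(2)] by blast
  then have "A \<in> regions"
    unfolding regions_def using C0 by blast
  with regions_empty show False
    by blast
qed

end
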